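(* Let $G=Cay(\mathbb Z_n,\pm1,\pm2,\dots,\pm k)$ and $H=Cay(\mathbb Z_m,\pm1,\pm2,\dots,\pm k)$, where $1\le 2k<n<m$ are integers. Then $\alpha^*(G|H)\ge \frac nm$. Moreover $\alpha^*(G|H)=\frac nm$ if there are integers $\ell,s\ge 0$ with $m=\ell n+s(k+1)$.
   Context: All graphs are finite, simple, undirected; $\boxtimes$ is the strong product and $\alpha^*(G|H)=\sup_W\frac{\alpha(G\boxtimes W)}{\alpha(H\boxtimes W)}$ over all graphs $W$. $Cay(\mathbb Z_n,\pm1,\dots,\pm k)$ is the graph on $\mathbb Z_n$ with $a,b$ adjacent iff $a-b\in\{\pm1,\dots,\pm k\}$.
   Formalization: The case n = 2k+1 is excluded: there G is complete and the claimed bound α*(G|H) ≥ n/m fails for every m > n (for example k=1, n=3, m=4 gives α*(G|H) ≤ 1/2 < 3/4). *)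

theory Defs
  imports
    "Graph_Theory.Pair_Digraph"
    "HOL-Library.Extended_Real"
    "HOL-Number_Theory.Cong"
begin

text \<open>
  Finite simple undirected graphs are the symmetric loop-free digraphs of the locale
  \<^locale>\<open>pair_graph\<close>; each edge is represented by its two orientations.
\<close>

definition independent_set :: "'a pair_pre_digraph \<Rightarrow> 'a set \<Rightarrow> bool" where
  "independent_set G S \<longleftrightarrow>
     S \<subseteq> pverts G \<and> (\<forall>u\<in>S. \<forall>v\<in>S. u \<noteq> v \<longrightarrow> (u, v) \<notin> parcs G)"

definition independence_number :: "'a pair_pre_digraph \<Rightarrow> nat" where
  "independence_number G = Max (card ` {S. independent_set G S})"

definition strong_product ::
    "'a pair_pre_digraph \<Rightarrow> 'b pair_pre_digraph \<Rightarrow> ('a \<times> 'b) pair_pre_digraph"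
    (infixl \<open>\<boxtimes>\<close> 70) where
  "G \<boxtimes> H = \<lparr>
     pverts = pverts G \<times> pverts H,
     parcs = {((u, v), (u', v')).
        u \<in> pverts G \<and> u' \<in> pverts G \<and> v \<in> pverts H \<and> v' \<in> pverts H \<and>
        (u, v) \<noteq> (u', v') \<and>
        (u = u' \<or> (u, u') \<in> parcs G) \<and> (v = v' \<or> (v, v') \<in> parcs H)} \<rparr>"

text \<open>
  The supremum ranges over all finite simple graphs with at least one vertex (for the null
  graph the quotient is 0/0). Taking the vertices of \<open>W\<close> to be natural numbers loses nothing,
  since every finite graph is isomorphic to such a graph; see \<open>alpha_star_upper\<close> below.
  The supremum is taken in \<^typ>\<open>ereal\<close>, where it always exists; it is finite whenever \<open>G\<close> and
  \<open>H\<close> are finite and \<open>H\<close> has a vertex, and in that case no denominator vanishes.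
\<close>

definition alpha_star :: "'a pair_pre_digraph \<Rightarrow> 'b pair_pre_digraph \<Rightarrow> ereal" where
  "alpha_star G H =
     (SUP W \<in> {W :: nat pair_pre_digraph. pair_graph W \<and> pverts W \<noteq> {}}.
        ereal (real (independence_number (G \<boxtimes> W)) / real (independence_number (H \<boxtimes> W))))"

text \<open>The graph \<open>Cay(\<int>\<^sub>n, \<plusminus>1, \<dots>, \<plusminus>k)\<close>, with the residue classes represented by \<open>0, \<dots>, n - 1\<close>.\<close>

definition cayley_cycle :: "nat \<Rightarrow> nat \<Rightarrow> int pair_pre_digraph" where
  "cayley_cycle n k = \<lparr>
     pverts = {0..<int n},
     parcs = {(a, b). a \<in> {0..<int n} \<and> b \<in> {0..<int n} \<and>
        (\<exists>j\<in>{1..int k}. [a - b = j] (mod int n) \<or> [a - b = - j] (mod int n))} \<rparr>"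

lemma pair_graphI:
  assumes "finite (pverts G)" "parcs G \<subseteq> pverts G \<times> pverts G"
    "sym (parcs G)" "\<And>v. (v, v) \<notin> parcs G"
  shows "pair_graph G"
proof
  show "finite (parcs G)"
    using assms(1,2) finite_subset by blast
  show "symmetric (with_proj G)"
    using assms(3) by (simp add: symmetric_def)
qed (use assms in auto)

lemma pair_graphD:
  assumes "pair_graph G"
  shows "finite (pverts G)" "parcs G \<subseteq> pverts G \<times> pverts G"
    "sym (parcs G)" "(v, v) \<notin> parcs G"
proof -
  interpret pair_graph G by fact
  show "finite (pverts G)" by (rule pair_finite_verts)
  show "parcs G \<subseteq> pverts G \<times> pverts G" by (auto dest: in_arcsD1 in_arcsD2)
  show "sym (parcs G)" using pair_sym_arcs by (simp add: symmetric_def)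
  show "(v, v) \<notin> parcs G" using pair_no_loops by force
qed

lemma pair_graph_strong_product:
  assumes "pair_graph G" "pair_graph H"
  shows "pair_graph (G \<boxtimes> H)"
  using pair_graphD[OF assms(1)] pair_graphD[OF assms(2)]
  by (intro pair_graphI) (auto simp: strong_product_def sym_def)

lemma pair_graph_cayley_cycle:
  assumes "k < n"
  shows "pair_graph (cayley_cycle n k)"
proof (rule pair_graphI)
  show "sym (parcs (cayley_cycle n k))"
  proof (rule symI)
    fix a b assume "(a, b) \<in> parcs (cayley_cycle n k)"
    then obtain j where ab: "a \<in> {0..<int n}" "b \<in> {0..<int n}" and j: "j \<in> {1..int k}"
      and c: "[a - b = j] (mod int n) \<or> [a - b = - j] (mod int n)"
      by (auto simp: cayley_cycle_def)
    have "[b - a = - j] (mod int n) \<or> [b - a = j] (mod int n)"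
      using c cong_minus_minus_iff[of "a - b" j "int n"] cong_minus_minus_iff[of "a - b" "- j" "int n"]
      by auto
    then show "(b, a) \<in> parcs (cayley_cycle n k)"
      using ab j by (auto simp: cayley_cycle_def)
  qed
next
  fix v
  have "\<not> int n dvd j" if "j \<in> {1..int k}" for j
    using that assms zdvd_imp_le[of "int n" j] by auto
  then show "(v, v) \<notin> parcs (cayley_cycle n k)"
    by (auto simp: cayley_cycle_def cong_iff_dvd_diff)
qed (auto simp: cayley_cycle_def)

lemma independence_number_iso:
  assumes bij: "bij_betw f (pverts G) (pverts H)"
    and arcs: "\<And>u v. u \<in> pverts G \<Longrightarrow> v \<in> pverts G \<Longrightarrow>
      (f u, f v) \<in> parcs H \<longleftrightarrow> (u, v) \<in> parcs G"
  shows "independence_number G = independence_number H"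
proof -
  have inj: "inj_on f (pverts G)" and im: "f ` pverts G = pverts H"
    using bij by (auto simp: bij_betw_def)
  have iff: "independent_set H (f ` S) \<longleftrightarrow> independent_set G S" if "S \<subseteq> pverts G" for S
    using that im arcs inj unfolding independent_set_def
    by (auto simp: inj_on_eq_iff subset_iff)
  have cards: "card (f ` S) = card S" if "S \<subseteq> pverts G" for S
    using inj_on_subset[OF inj that] by (rule card_image)
  have "card ` {S. independent_set G S} = card ` {S. independent_set H S}"
  proof (intro equalityI subsetI)
    fix x assume "x \<in> card ` {S. independent_set G S}"
    then obtain S where S: "independent_set G S" "x = card S" by auto
    then have "S \<subseteq> pverts G" by (simp add: independent_set_def)
    with S iff cards show "x \<in> card ` {S. independent_set H S}"
      by (metis image_eqI mem_Collect_eq)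
  next
    fix x assume "x \<in> card ` {S. independent_set H S}"
    then obtain T where T: "independent_set H T" "x = card T" by auto
    then have "T \<subseteq> f ` pverts G" using im by (simp add: independent_set_def)
    then obtain S where "S \<subseteq> pverts G" "T = f ` S" by (meson subset_imageE)
    with T iff cards show "x \<in> card ` {S. independent_set G S}"
      by (metis image_eqI mem_Collect_eq)
  qed
  then show ?thesis by (simp add: independence_number_def)
qed

lemma independence_number_strong_product_iso:
  assumes bij: "bij_betw f (pverts W) (pverts W')"
    and arcs: "\<And>u v. u \<in> pverts W \<Longrightarrow> v \<in> pverts W \<Longrightarrow>
      (f u, f v) \<in> parcs W' \<longleftrightarrow> (u, v) \<in> parcs W"
  shows "independence_number (G \<boxtimes> W) = independence_number (G \<boxtimes> W')"
proof (rule independence_number_iso)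
  show "bij_betw (map_prod id f) (pverts (G \<boxtimes> W)) (pverts (G \<boxtimes> W'))"
    using bij_betw_map_prod[OF bij_betw_id bij] by (simp add: strong_product_def)
next
  fix x y assume "x \<in> pverts (G \<boxtimes> W)" "y \<in> pverts (G \<boxtimes> W)"
  then obtain a u b v where xy: "x = (a, u)" "y = (b, v)"
      "a \<in> pverts G" "b \<in> pverts G" "u \<in> pverts W" "v \<in> pverts W"
    by (auto simp: strong_product_def)
  have "f u \<in> pverts W'" "f v \<in> pverts W'" "f u = f v \<longleftrightarrow> u = v"
    using bij xy by (auto simp: bij_betw_def inj_on_eq_iff)
  with xy arcs show "(map_prod id f x, map_prod id f y) \<in> parcs (G \<boxtimes> W') \<longleftrightarrow>
      (x, y) \<in> parcs (G \<boxtimes> W)"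
    by (auto simp: strong_product_def)
qed

lemma alpha_star_upper:
  fixes W :: "'c pair_pre_digraph"
  assumes W: "pair_graph W" "pverts W \<noteq> {}"
  shows "ereal (real (independence_number (G \<boxtimes> W)) / real (independence_number (H \<boxtimes> W)))
    \<le> alpha_star G H"
proof -
  note D = pair_graphD[OF W(1)]
  obtain f :: "'c \<Rightarrow> nat" where inj: "inj_on f (pverts W)"
    using finite_imp_inj_to_nat_seg[OF D(1)] by blast
  define W' where "W' = \<lparr> pverts = f ` pverts W, parcs = map_prod f f ` parcs W \<rparr>"
  have arcs: "(f u, f v) \<in> parcs W' \<longleftrightarrow> (u, v) \<in> parcs W"
    if "u \<in> pverts W" "v \<in> pverts W" for u v
    using that D(2) inj by (force simp: W'_def inj_on_eq_iff)
  have bij: "bij_betw f (pverts W) (pverts W')"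
    using inj by (simp add: W'_def bij_betw_def)
  have "pair_graph W'"
  proof (rule pair_graphI)
    show "sym (parcs W')"
      using D(3) by (force simp: W'_def sym_def)
    show "(v, v) \<notin> parcs W'" for v
    proof
      assume "(v, v) \<in> parcs W'"
      then obtain a b where ab: "(a, b) \<in> parcs W" "v = f a" "v = f b" by (auto simp: W'_def)
      then have "a = b" using D(2) inj by (auto simp: inj_on_eq_iff)
      with ab D(4) show False by simp
    qed
  qed (use D in \<open>auto simp: W'_def\<close>)
  moreover have "pverts W' \<noteq> {}" using W(2) by (simp add: W'_def)
  ultimately have "W' \<in> {W. pair_graph W \<and> pverts W \<noteq> {}}" by simp
  from SUP_upper[OF this] show ?thesis
    by (simp add: alpha_star_def independence_number_strong_product_iso[OF bij arcs])
qed

lemma finite_independent_sets: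
  assumes "finite (pverts G)"
  shows "finite {S. independent_set G S}"
  by (rule finite_subset[of _ "Pow (pverts G)"]) (use assms in \<open>auto simp: independent_set_def\<close>)

lemma card_le_independence_number:
  assumes "finite (pverts G)" "independent_set G S"
  shows "card S \<le> independence_number G"
  unfolding independence_number_def
  by (intro Max_ge finite_imageI finite_independent_sets) (use assms in auto)

lemma independence_number_attained:
  assumes "finite (pverts G)"
  obtains S where "independent_set G S" "card S = independence_number G"
proof -
  have "independent_set G {}" by (simp add: independent_set_def)
  then have "independence_number G \<in> card ` {S. independent_set G S}"
    unfolding independence_number_def
    by (intro Max_in finite_imageI finite_independent_sets assms) auto
  with that show ?thesis by auto
qed

lemma cayley_cycle_complete:
  assumes "a \<in> {0..<int (2 * k + 1)}" "b \<in> {0..<int (2 * k + 1)}" "a \<noteq> b"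
  shows "(a, b) \<in> parcs (cayley_cycle (2 * k + 1) k)"
proof -
  let ?n = "int (2 * k + 1)"
  consider "a - b \<in> {1..int k}" | "b - a \<in> {1..int k}"
    | "?n - (a - b) \<in> {1..int k}" | "?n - (b - a) \<in> {1..int k}"
    using assms by fastforce
  then have "\<exists>j\<in>{1..int k}. [a - b = j] (mod ?n) \<or> [a - b = - j] (mod ?n)"
  proof cases
    case 1
    then show ?thesis by (intro bexI[of _ "a - b"]) auto
  next
    case 2
    then show ?thesis by (intro bexI[of _ "b - a"]) auto
  next
    case 3
    have "[a - b = - (?n - (a - b))] (mod ?n)"
    proof -
      have "(a - b) - - (?n - (a - b)) = ?n" by simp
      then show ?thesis by (simp only: cong_iff_dvd_diff dvd_refl)
    qed
    with 3 show ?thesis by blast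
  next
    case 4
    have "[a - b = ?n - (b - a)] (mod ?n)"
    proof -
      have "(a - b) - (?n - (b - a)) = - ?n" by simp
      then show ?thesis by (simp only: cong_iff_dvd_diff dvd_minus_iff dvd_refl)
    qed
    with 4 show ?thesis by blast
  qed
  with assms show ?thesis by (simp add: cayley_cycle_def)
qed

lemma cayley_cycle_nonadjacent:
  fixes i i' :: nat
  assumes "i < m div (k + 1)" "i' < m div (k + 1)"
  shows "(int (i * (k + 1)), int (i' * (k + 1))) \<notin> parcs (cayley_cycle m k)"
proof
  let ?q = "m div (k + 1)"
  let ?d = "int (i * (k + 1)) - int (i' * (k + 1))"
  assume arc: "(int (i * (k + 1)), int (i' * (k + 1))) \<in> parcs (cayley_cycle m k)"
  obtain j where j: "1 \<le> \<bar>j\<bar>" "\<bar>j\<bar> \<le> int k" and dvd: "int m dvd ?d - j"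
  proof -
    from arc obtain j0 where "j0 \<in> {1..int k}"
      and "[?d = j0] (mod int m) \<or> [?d = - j0] (mod int m)"
      by (auto simp: cayley_cycle_def)
    then show ?thesis using that[of j0] that[of "- j0"] by (auto simp: cong_iff_dvd_diff)
  qed
  have d: "?d = (int i - int i') * (int k + 1)" by (simp add: algebra_simps)
  have qm: "int ?q * (int k + 1) \<le> int m"
    using div_times_less_eq_dividend[of m "k + 1"] by (metis of_nat_1 of_nat_add of_nat_le_iff of_nat_mult)
  have "\<bar>?d\<bar> = \<bar>int i - int i'\<bar> * (int k + 1)" unfolding d by (simp add: abs_mult)
  also have "\<dots> \<le> (int ?q - 1) * (int k + 1)"
    using assms by (intro mult_right_mono) auto
  also have "\<dots> \<le> int m - (int k + 1)" using qm by (simp add: algebra_simps)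
  finally have "\<bar>?d - j\<bar> < int m" using j by linarith
  with dvd have "?d = j" using dvd_imp_le_int[of "?d - j" "int m"] by fastforce
  with j d have "i \<noteq> i'" by auto
  then have "1 * (int k + 1) \<le> \<bar>int i - int i'\<bar> * (int k + 1)" by (intro mult_right_mono) auto
  also have "\<dots> = \<bar>(int i - int i') * (int k + 1)\<bar>" by (simp add: abs_mult)
  also have "\<dots> = \<bar>j\<bar>" using \<open>?d = j\<close> unfolding d by (simp only:)
  finally have "int k + 1 \<le> \<bar>j\<bar>" by (simp only: mult_1)
  also have "\<dots> \<le> int k" by (rule j(2))
  finally show False by simp
qed

text \<open>
  For \<open>n = 2 * k + 1\<close> the graph \<open>Cay(\<int>\<^sub>n, \<plusminus>1, \<dots>, \<plusminus>k)\<close> is complete, and the bound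
  \<open>\<alpha>\<^sup>*(G|H) \<ge> n/m\<close> fails for every \<open>m > n\<close>. The smallest instance is \<open>\<alpha>\<^sup>*(C\<^sub>3|C\<^sub>4) \<le> 1/2 < 3/4\<close>.
  Hence any such lower bound has to assume \<open>n \<noteq> 2 * k + 1\<close>.
\<close>

lemma alpha_star_complete_less:
  assumes "1 \<le> k" "n = 2 * k + 1" "n < m"
  shows "alpha_star (cayley_cycle n k) (cayley_cycle m k) < ereal (real n / real m)"
proof -
  let ?G = "cayley_cycle n k" and ?H = "cayley_cycle m k"
  define q where "q = m div (k + 1)"
  have "2 * (k + 1) \<le> m" using assms by simp
  then have q2: "2 \<le> q" unfolding q_def by (simp add: less_eq_div_iff_mult_less_eq)
  define r where "r = m mod (k + 1)"
  have m: "m = q * (k + 1) + r" unfolding q_def r_def by (rule div_mult_mod_eq[symmetric])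
  have "r < k + 1" unfolding r_def by simp
  also have "\<dots> \<le> 2 * k" using assms(1) by simp
  also have "\<dots> \<le> q * k" using q2 by (rule mult_le_mono1)
  finally have "m < q * k + q * (k + 1)" unfolding m using add_strict_right_mono[of r "q * k" "q * (k + 1)"] by (simp only: add.commute[of r])
  also have "\<dots> = q * n" using assms(2) by (simp add: algebra_simps)
  finally have "m < q * n" .
  then have less: "1 / real q < real n / real m"
    using q2 assms(3) by (simp add: field_simps flip: of_nat_mult)
  have "alpha_star ?G ?H \<le> ereal (1 / real q)"
    unfolding alpha_star_def
  proof (rule SUP_least)
    fix W :: "nat pair_pre_digraph"
    assume "W \<in> {W. pair_graph W \<and> pverts W \<noteq> {}}"
    then have finW: "finite (pverts W)" using pair_graphD(1) by auto
    then have fin: "finite (pverts (?G \<boxtimes> W))" "finite (pverts (?H \<boxtimes> W))"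
      by (simp_all add: strong_product_def cayley_cycle_def)
    obtain S where S: "independent_set (?G \<boxtimes> W) S"
      and cardS: "card S = independence_number (?G \<boxtimes> W)"
      using independence_number_attained[OF fin(1)] .
    have verts: "a \<in> {0..<int n}" "w \<in> pverts W" if "(a, w) \<in> S" for a w
      using S that by (auto simp: independent_set_def strong_product_def cayley_cycle_def)
    have sep: "w \<noteq> w' \<and> (w, w') \<notin> parcs W"
      if "(a, w) \<in> S" "(a', w') \<in> S" "(a, w) \<noteq> (a', w')" for a w a' w'
    proof -
      have "a = a' \<or> (a, a') \<in> parcs ?G"
        using verts(1)[OF that(1)] verts(1)[OF that(2)] cayley_cycle_complete[of a k a'] assms(2)
        by auto
      moreover have "((a, w), (a', w')) \<notin> parcs (?G \<boxtimes> W)"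
        using S that by (auto simp: independent_set_def)
      ultimately show ?thesis
        using that verts by (auto simp: strong_product_def cayley_cycle_def)
    qed
    have inj: "inj_on snd S"
    proof (rule inj_onI)
      fix x y assume "x \<in> S" "y \<in> S" "snd x = snd y"
      then show "x = y"
        using sep[of "fst x" "snd x" "fst y" "snd y"] unfolding prod.collapse by blast
    qed
    define T where "T = (\<lambda>i. int (i * (k + 1))) ` {..<q} \<times> snd ` S"
    have "independent_set (?H \<boxtimes> W) T"
      unfolding independent_set_def
    proof (intro conjI ballI impI)
      have "int (i * (k + 1)) \<in> {0..<int m}" if "i < q" for i
      proof -
        have "i * (k + 1) < q * (k + 1)" using that by (intro mult_strict_right_mono) auto
        also have "\<dots> \<le> m" unfolding q_def by (rule div_times_less_eq_dividend)
        finally show ?thesis by (simp only: atLeastLessThan_iff of_nat_less_iff of_nat_0_le_iff)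
      qed
      then show "T \<subseteq> pverts (?H \<boxtimes> W)"
        using verts(2) by (auto simp: T_def strong_product_def cayley_cycle_def
            simp del: of_nat_mult of_nat_add)
    next
      fix x y assume "x \<in> T" "y \<in> T" "x \<noteq> y"
      then obtain i i' w w' where xy: "x = (int (i * (k + 1)), w)" "y = (int (i' * (k + 1)), w')"
          "i < q" "i' < q" "w \<in> snd ` S" "w' \<in> snd ` S"
        unfolding T_def by blast
      then obtain a a' where aw: "(a, w) \<in> S" "(a', w') \<in> S" by auto
      have nadj: "(int (i * (k + 1)), int (i' * (k + 1))) \<notin> parcs ?H"
        using xy(3,4) unfolding q_def by (rule cayley_cycle_nonadjacent)
      show "(x, y) \<notin> parcs (?H \<boxtimes> W)"
      proof (cases "w = w'")
        case True
        with \<open>x \<noteq> y\<close> xy(1,2) nadj show ?thesis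
          by (simp add: strong_product_def del: of_nat_mult of_nat_add)
      next
        case False
        with sep[OF aw] have "(w, w') \<notin> parcs W" by blast
        with False xy(1,2) show ?thesis by (simp add: strong_product_def)
      qed
    qed
    then have "card T \<le> independence_number (?H \<boxtimes> W)"
      by (rule card_le_independence_number[OF fin(2)])
    moreover have "card T = q * card S"
    proof -
      have "inj_on (\<lambda>i. int (i * (k + 1))) {..<q}"
        by (rule inj_onI) (simp only: of_nat_eq_iff mult_cancel2, simp)
      then show ?thesis
        by (simp add: T_def card_cartesian_product card_image inj)
    qed
    ultimately have le: "q * independence_number (?G \<boxtimes> W) \<le> independence_number (?H \<boxtimes> W)"
      using cardS by simp
    show "ereal (real (independence_number (?G \<boxtimes> W)) / real (independence_number (?H \<boxtimes> W)))
        \<le> ereal (1 / real q)"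
    proof (cases "independence_number (?H \<boxtimes> W) = 0")
      case False
      have "real q * real (independence_number (?G \<boxtimes> W)) \<le> real (independence_number (?H \<boxtimes> W))"
        using le by (simp flip: of_nat_mult)
      with False q2 show ?thesis by (simp add: field_simps)
    qed simp
  qed
  also have "\<dots> < ereal (real n / real m)" using less by simp
  finally show ?thesis .
qed

end

theory Submission
  imports Defs
begin

text \<open>
  Lower bound: take for \<open>W\<close> the complement of \<open>G\<close>. The diagonal is an independent set of size
  \<open>n\<close> in \<open>G \<boxtimes> W\<close>. As \<open>n \<ge> 2 * k + 2\<close>, cliques of \<open>G\<close> have at most \<open>k + 1\<close> elements, so an
  independent set of \<open>H \<boxtimes> W\<close> has at most \<open>k + 1\<close> elements above each of the \<open>m\<close> windows
  \<open>{p, \<dots>, p + k}\<close>, which are cliques of \<open>H\<close>; every element lies above \<open>k + 1\<close> windows, so there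
  are at most \<open>m\<close> elements.

  Upper bound: an independent set of \<open>G \<boxtimes> W\<close> can be pulled back to \<open>H \<boxtimes> W\<close> along any
  homomorphism from \<open>H\<close> to \<open>G\<close>. Averaging over the rotations of \<open>G\<close> gives
  \<open>m * \<alpha>(G \<boxtimes> W) \<le> n * \<alpha>(H \<boxtimes> W)\<close>. If \<open>m = l * n + s * (k + 1)\<close>, a homomorphism winds \<open>l\<close> times
  around \<open>G\<close> and then runs \<open>s\<close> times through the clique \<open>{0, \<dots>, k}\<close>.
\<close>

section \<open>Adjacency as divisibility\<close>

lemma pverts_cayley_cycle [simp]: "pverts (cayley_cycle n k) = {0..<int n}"
  by (simp add: cayley_cycle_def)

text \<open>One signed shift \<open>j\<close> merges the two congruences of the definition, so that
  adjacencies can be combined by adding and subtracting divisibilities.\<close>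

lemma cayley_cycle_arc_iff:
  "(a, b) \<in> parcs (cayley_cycle n k) \<longleftrightarrow>
    a \<in> {0..<int n} \<and> b \<in> {0..<int n} \<and>
    (\<exists>j. 1 \<le> \<bar>j\<bar> \<and> \<bar>j\<bar> \<le> int k \<and> int n dvd a - b - j)"
  (is "?L \<longleftrightarrow> ?R")
proof
  assume ?L
  then obtain j0 where ab: "a \<in> {0..<int n}" "b \<in> {0..<int n}" and j0: "j0 \<in> {1..int k}"
    and "[a - b = j0] (mod int n) \<or> [a - b = - j0] (mod int n)"
    by (auto simp: cayley_cycle_def)
  then have "int n dvd a - b - j0 \<or> int n dvd a - b - (- j0)"
    by (simp only: cong_iff_dvd_diff)
  moreover have "1 \<le> \<bar>j0\<bar>" "\<bar>j0\<bar> \<le> int k" "1 \<le> \<bar>- j0\<bar>" "\<bar>- j0\<bar> \<le> int k" using j0 by auto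
  ultimately show ?R using ab by blast
next
  assume ?R
  then obtain j where ab: "a \<in> {0..<int n}" "b \<in> {0..<int n}"
    and j: "1 \<le> \<bar>j\<bar>" "\<bar>j\<bar> \<le> int k" "[a - b = j] (mod int n)"
    by (auto simp: cong_iff_dvd_diff)
  have "\<bar>j\<bar> \<in> {1..int k}" using j by simp
  moreover have "[a - b = \<bar>j\<bar>] (mod int n) \<or> [a - b = - \<bar>j\<bar>] (mod int n)"
    using j(3) by (cases "j \<ge> 0") auto
  ultimately show ?L using ab unfolding cayley_cycle_def by auto
qed

lemma cayley_cycle_arcI:
  assumes "a \<in> {0..<int n}" "b \<in> {0..<int n}" "1 \<le> \<bar>j\<bar>" "\<bar>j\<bar> \<le> int k" "int n dvd a - b - j"
  shows "(a, b) \<in> parcs (cayley_cycle n k)"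
  using assms cayley_cycle_arc_iff by blast

lemma cayley_cycle_sym:
  "(a, b) \<in> parcs (cayley_cycle n k) \<Longrightarrow> (b, a) \<in> parcs (cayley_cycle n k)"
  by (auto simp: cayley_cycle_def) 
    (metis atLeastAtMost_iff cong_minus_minus_iff minus_diff_eq minus_minus)+

lemma eq_of_dvd_diff:
  fixes a b n :: int
  assumes "n dvd a - b" "\<bar>a - b\<bar> < n"
  shows "a = b"
  using assms dvd_imp_le_int[of "a - b" n] by fastforce

lemma finite_pverts_strong_product:
  "finite (pverts G) \<Longrightarrow> finite (pverts H) \<Longrightarrow> finite (pverts (G \<boxtimes> H))"
  by (simp add: strong_product_def)

section \<open>Size of cliques\<close>

lemma card_clique_cayley_cycle:
  assumes n: "2 * k + 2 \<le> n"
    and S: "S \<subseteq> {0..<int n}"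
    and clique: "\<And>x y. x \<in> S \<Longrightarrow> y \<in> S \<Longrightarrow> x \<noteq> y \<Longrightarrow> (x, y) \<in> parcs (cayley_cycle n k)"
  shows "card S \<le> k + 1"
proof (cases "S = {}")
  case False
  then obtain x where x: "x \<in> S" by blast
  define d where "d y = (y - x) mod int n" for y
  \<comment> \<open>Every element of \<open>S\<close> has offset at most \<open>k\<close> or at least \<open>n - k\<close> from \<open>x\<close>;
    of the offsets \<open>i\<close> and \<open>i + (n - k - 1)\<close> at most one occurs.\<close>
  define g where "g y = (if d y \<le> int k then d y else d y - (int n - int k - 1))" for y
  have d: "0 \<le> d y" "d y < int n" for y using n by (auto simp: d_def)
  have d_dvd: "int n dvd d y - (y - x)" for y
    unfolding d_def by (simp add: mod_eq_dvd_iff [symmetric])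
  have range: "d y \<le> int k \<or> int n - int k \<le> d y" if "y \<in> S" for y
  proof (cases "y = x")
    case False
    with clique[OF that x] obtain j where j: "\<bar>j\<bar> \<le> int k" "int n dvd y - x - j"
      by (auto simp: cayley_cycle_arc_iff)
    from dvd_add[OF d_dvd[of y] j(2)] have dj: "int n dvd d y - j" by (simp add: algebra_simps)
    show ?thesis
    proof (rule ccontr)
      assume "\<not> ?thesis"
      then have "d y - j \<noteq> 0" "\<bar>d y - j\<bar> < int n" using j(1) d[of y] by auto
      with eq_of_dvd_diff[OF dj] show False by simp
    qed
  qed (simp add: d_def)
  have no_shift: False if y: "y \<in> S" "z \<in> S" "d z = d y + (int n - int k - 1)" for y z
  proof -
    have *: "int n dvd z - y - (int n - int k - 1)"
      using dvd_diff[OF d_dvd[of y] d_dvd[of z]] y(3) by (simp add: algebra_simps)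
    have "z \<noteq> y" using y(3) n by auto
    with clique y obtain j where j: "\<bar>j\<bar> \<le> int k" "int n dvd z - y - j"
      by (auto simp: cayley_cycle_arc_iff)
    \<comment> \<open>Adjacency yields a multiple of \<open>n\<close>, but
      \<open>2 * k + 2 \<le> n\<close> and \<open>\<bar>j\<bar> \<le> k\<close> keep it strictly
      between 0 and \<open>n\<close>.\<close>
    have "int n dvd int n - int k - 1 - j" using dvd_diff[OF j(2) *] by (simp add: algebra_simps)
    moreover have "0 < int n - int k - 1 - j" "int n - int k - 1 - j < int n" using j(1) n by auto
    ultimately show False using zdvd_not_zless by blast
  qed
  have inj: "inj_on g S"
  proof (rule inj_onI)
    fix y z assume yz: "y \<in> S" "z \<in> S" "g y = g z"
    have "d y = d z"
      using yz(3) no_shift[of y z] no_shift[of z y] yz(1,2) unfolding g_def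
      by (smt (verit))
    then have "int n dvd y - z"
      using dvd_diff[OF d_dvd[of z] d_dvd[of y]] by simp
    moreover have "y \<in> {0..<int n}" "z \<in> {0..<int n}" using S yz(1,2) by blast+
    ultimately show "y = z" by (intro eq_of_dvd_diff[of "int n"]) auto
  qed
  have "g y \<in> {0..int k}" if "y \<in> S" for y
    using range[OF that] d[of y] n unfolding g_def by auto
  then have "g ` S \<subseteq> {0..int k}" by blast
  then have "card S \<le> card {0..int k}" by (rule card_inj_on_le[OF inj]) simp
  then show ?thesis by simp
qed simp

section \<open>Lower bound: testing with the complement\<close>

definition complement_graph :: "'a pair_pre_digraph \<Rightarrow> 'a pair_pre_digraph" where
  "complement_graph G = \<lparr> pverts = pverts G,
     parcs = {(a, b). a \<in> pverts G \<and> b \<in> pverts G \<and> a \<noteq> b \<and> (a, b) \<notin> parcs G} \<rparr>"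

lemma pverts_complement_graph [simp]: "pverts (complement_graph G) = pverts G"
  by (simp add: complement_graph_def)

lemma pair_graph_complement_graph:
  assumes "pair_graph G"
  shows "pair_graph (complement_graph G)"
  using pair_graphD[OF assms]
  by (intro pair_graphI) (auto simp: complement_graph_def sym_def)

text \<open>Distinct diagonal points could be adjacent only if their coordinates were adjacent both
  in \<open>G\<close> and in its complement.\<close>

lemma card_le_independence_number_complement:
  assumes "pair_graph G"
  shows "card (pverts G) \<le> independence_number (G \<boxtimes> complement_graph G)"
proof -
  let ?D = "(\<lambda>a. (a, a)) ` pverts G"
  have "independent_set (G \<boxtimes> complement_graph G) ?D"
    by (auto simp: independent_set_def strong_product_def complement_graph_def)
  moreover have "card ?D = card (pverts G)" by (intro card_image inj_onI) simp
  ultimately show ?thesis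
    using card_le_independence_number[OF finite_pverts_strong_product, of G "complement_graph G" ?D]
      pair_graphD(1)[OF assms] by simp
qed

text \<open>Double counting of incidences between elements and windows. Above a window, which is a
  clique, the second projection is injective onto an independent set of \<open>W\<close>. The
  complement of \<open>G\<close> enters later, with \<open>c = k + 1\<close>.\<close>

lemma independence_number_strong_product_cayley_cycle_le:
  assumes k: "k < m" and fin: "finite (pverts W)"
    and alpha: "\<And>T. independent_set W T \<Longrightarrow> card T \<le> c"
  shows "(k + 1) * independence_number (cayley_cycle m k \<boxtimes> W) \<le> m * c"
proof -
  let ?H = "cayley_cycle m k"
  have finP: "finite (pverts (?H \<boxtimes> W))" by (simp add: finite_pverts_strong_product fin)
  obtain J where J: "independent_set (?H \<boxtimes> W) J" "card J = independence_number (?H \<boxtimes> W)"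
    using independence_number_attained[OF finP] .
  have finJ: "finite J" using J(1) finP finite_subset by (auto simp: independent_set_def)
  have verts: "a \<in> {0..<int m}" "w \<in> pverts W" if "(a, w) \<in> J" for a w
    using J(1) that by (auto simp: independent_set_def strong_product_def)
  define A where "A p = {(a, w) \<in> J. \<exists>i\<in>{0..int k}. int m dvd a - i - p}" for p
  have finA: "finite (A p)" for p by (rule finite_subset[OF _ finJ]) (auto simp: A_def)
  have cardA: "card (A p) \<le> c" for p
  proof -
    have window: "a = b \<or> (a, b) \<in> parcs ?H"
      if ab: "(a, v) \<in> A p" "(b, w) \<in> A p" for a b v w
    proof -
      from ab obtain i j where ij: "i \<in> {0..int k}" "j \<in> {0..int k}"
          "int m dvd a - i - p" "int m dvd b - j - p"
        and range: "a \<in> {0..<int m}" "b \<in> {0..<int m}"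
        using verts by (auto simp: A_def)
      have dvd: "int m dvd a - b - (i - j)"
        using dvd_diff[OF ij(3,4)] by (simp add: algebra_simps)
      show ?thesis
      proof (cases "i = j")
        case True
        have "a = b" by (rule eq_of_dvd_diff[of "int m"]) (use dvd True range in auto)
        then show ?thesis ..
      next
        case False
        with range dvd ij show ?thesis by (intro disjI2 cayley_cycle_arcI[of _ _ _ "i - j"]) auto
      qed
    qed
    have sep: "v \<noteq> w \<and> (v, w) \<notin> parcs W"
      if "(a, v) \<in> A p" "(b, w) \<in> A p" "(a, v) \<noteq> (b, w)" for a v b w
    proof -
      have "(a, v) \<in> J" "(b, w) \<in> J" using that by (auto simp: A_def)
      then have "((a, v), (b, w)) \<notin> parcs (?H \<boxtimes> W)"
        "a \<in> {0..<int m}" "b \<in> {0..<int m}" "v \<in> pverts W" "w \<in> pverts W"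
        using J(1) that verts by (auto simp: independent_set_def)
      with window[OF that(1,2)] that(3) show ?thesis by (auto simp: strong_product_def)
    qed
    have "inj_on snd (A p)"
    proof (rule inj_onI)
      fix x y assume "x \<in> A p" "y \<in> A p" "snd x = snd y"
      then show "x = y"
        using sep[of "fst x" "snd x" "fst y" "snd y"] unfolding prod.collapse by blast
    qed
    moreover have "independent_set W (snd ` A p)"
      unfolding independent_set_def
    proof (intro conjI ballI impI)
      show "snd ` A p \<subseteq> pverts W" using verts by (auto simp: A_def)
    next
      fix v w assume "v \<in> snd ` A p" "w \<in> snd ` A p" "v \<noteq> w"
      then show "(v, w) \<notin> parcs W" using sep by fastforce
    qed
    ultimately show ?thesis using alpha by (metis card_image)
  qed
  \<comment> \<open>If \<open>x\<close> sits at offset \<open>i\<close> in a window, that window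
    starts at \<open>fst x - i\<close>; since \<open>k < m\<close>, the start determines
    \<open>i\<close>.\<close>
  let ?h = "\<lambda>(i, x). ((fst x - i) mod int m, x)"
  have "inj_on ?h ({0..int k} \<times> J)"
  proof (rule inj_onI, clarsimp)
    fix i j a assume ij: "0 \<le> i" "i \<le> int k" "0 \<le> j" "j \<le> int k"
      and "(a - i) mod int m = (a - j) mod int m"
    then have "int m dvd j - i" by (simp add: mod_eq_dvd_iff)
    moreover have "\<bar>j - i\<bar> < int m" using ij k by linarith
    ultimately show "i = j" using eq_of_dvd_diff by metis
  qed
  moreover have "?h ` ({0..int k} \<times> J) \<subseteq> Sigma {0..<int m} A"
  proof (rule image_subsetI)
    fix x assume "x \<in> {0..int k} \<times> J"
    then obtain i a w where x: "x = (i, (a, w))" and i: "i \<in> {0..int k}" and aw: "(a, w) \<in> J"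
      by (metis SigmaE surj_pair)
    have "int m dvd a - i - (a - i) mod int m" by (simp add: mod_eq_dvd_iff [symmetric])
    with i aw have "(a, w) \<in> A ((a - i) mod int m)" unfolding A_def by blast
    then show "?h x \<in> Sigma {0..<int m} A" using k by (simp add: x)
  qed
  moreover have "finite (Sigma {0..<int m} A)" using finA by blast
  ultimately have "card ({0..int k} \<times> J) \<le> card (Sigma {0..<int m} A)" by (rule card_inj_on_le)
  also have "\<dots> = (\<Sum>p\<in>{0..<int m}. card (A p))" using finA by (intro card_SigmaI) auto
  also have "\<dots> \<le> (\<Sum>p\<in>{0..<int m}. c)" using cardA by (intro sum_mono)
  finally show ?thesis
    using J(2) by (simp add: card_cartesian_product nat_add_distrib)
qed

text \<open>Secures a nonzero denominator; division by zero would give 0 and spoil the lower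
  bound.\<close>

lemma independence_number_strong_product_pos:
  assumes "finite (pverts G)" "finite (pverts H)" "u \<in> pverts G" "v \<in> pverts H"
  shows "0 < independence_number (G \<boxtimes> H)"
proof -
  have "independent_set (G \<boxtimes> H) {(u, v)}"
    using assms by (simp add: independent_set_def strong_product_def)
  from card_le_independence_number[OF finite_pverts_strong_product this] assms show ?thesis by simp
qed

lemma alpha_star_cayley_cycle_ge:
  assumes n: "2 * k + 2 \<le> n" and k: "k < m"
  shows "ereal (real n / real m) \<le> alpha_star (cayley_cycle n k) (cayley_cycle m k)"
proof -
  let ?G = "cayley_cycle n k" and ?H = "cayley_cycle m k"
  let ?W = "complement_graph ?G"
  have G: "pair_graph ?G" using n by (intro pair_graph_cayley_cycle) simp
  \<comment> \<open>Independent sets of the complement are cliques of \<open>?G\<close>; the factor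
    \<open>k + 1\<close> obtained here cancels against the window length.\<close>
  have "card T \<le> k + 1" if "independent_set ?W T" for T
  proof (rule card_clique_cayley_cycle[OF n])
    show "T \<subseteq> {0..<int n}" using that by (simp add: independent_set_def)
  next
    fix x y assume "x \<in> T" "y \<in> T" "x \<noteq> y"
    with that show "(x, y) \<in> parcs ?G"
      unfolding independent_set_def complement_graph_def by fastforce
  qed
  then have "(k + 1) * independence_number (?H \<boxtimes> ?W) \<le> m * (k + 1)"
    using independence_number_strong_product_cayley_cycle_le[OF k, of ?W "k + 1"] by simp
  then have "(k + 1) * independence_number (?H \<boxtimes> ?W) \<le> (k + 1) * m"
    by (simp only: mult.commute)
  then have le: "independence_number (?H \<boxtimes> ?W) \<le> m" by (simp only: mult_le_cancel1)
  have "0 < independence_number (?H \<boxtimes> ?W)"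
    by (rule independence_number_strong_product_pos[of _ _ 0 0]) (use n k in auto)
  moreover have "n \<le> independence_number (?G \<boxtimes> ?W)"
    using card_le_independence_number_complement[OF G] by simp
  ultimately have "real n / real m
      \<le> real (independence_number (?G \<boxtimes> ?W)) / real (independence_number (?H \<boxtimes> ?W))"
    using le by (intro frac_le) auto
  also have "ereal \<dots> \<le> alpha_star ?G ?H"
    by (rule alpha_star_upper[OF pair_graph_complement_graph[OF G]]) (use n in auto)
  finally show ?thesis by simp
qed

section \<open>Transfer along a homomorphism\<close>

text \<open>A single preimage of a maximum independent set may be small. Over all \<open>n\<close>
  rotations, however, each vertex of \<open>H\<close> meets each element of the set, so some
  preimage reaches the average.\<close>

lemma card_hom_mult_independence_number_le:
  assumes k: "k < n" and finH: "finite (pverts H)" and finW: "finite (pverts W)"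
    and f_verts: "\<And>p. p \<in> pverts H \<Longrightarrow> f p \<in> {0..<int n}"
    and f_arcs: "\<And>p q. (p, q) \<in> parcs H \<Longrightarrow> (f p, f q) \<in> parcs (cayley_cycle n k)"
  shows "card (pverts H) * independence_number (cayley_cycle n k \<boxtimes> W)
    \<le> n * independence_number (H \<boxtimes> W)"
proof -
  let ?G = "cayley_cycle n k"
  have n: "0 < n" using k by simp
  have finP: "finite (pverts (?G \<boxtimes> W))" by (simp add: finite_pverts_strong_product finW)
  obtain I where I: "independent_set (?G \<boxtimes> W) I" "card I = independence_number (?G \<boxtimes> W)"
    using independence_number_attained[OF finP] .
  have verts: "a \<in> {0..<int n}" "w \<in> pverts W" if "(a, w) \<in> I" for a w
    using I(1) that by (auto simp: independent_set_def strong_product_def)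
  define J where "J t = {(p, w) \<in> pverts H \<times> pverts W. ((f p + t) mod int n, w) \<in> I}" for t
  have finJ: "finite (J t)" for t
    by (rule finite_subset[of _ "pverts H \<times> pverts W"]) (use finH finW in \<open>auto simp: J_def\<close>)
  \<comment> \<open>Rotations are automorphisms of the Cayley graph.\<close>
  have rot: "((f p + t) mod int n, (f q + t) mod int n) \<in> parcs ?G" if "(p, q) \<in> parcs H" for p q t
  proof -
    from f_arcs[OF that] obtain j where j: "1 \<le> \<bar>j\<bar>" "\<bar>j\<bar> \<le> int k" "int n dvd f p - f q - j"
      by (auto simp: cayley_cycle_arc_iff)
    have "[(f p + t) mod int n - (f q + t) mod int n = (f p + t) - (f q + t)] (mod int n)"
      by (intro cong_diff) (simp_all add: cong_def)
    also have "[(f p + t) - (f q + t) = j] (mod int n)" using j(3) by (simp add: cong_iff_dvd_diff)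
    finally show ?thesis
      using j n by (intro cayley_cycle_arcI[of _ _ _ j]) (auto simp: cong_iff_dvd_diff)
  qed
  have "independent_set (H \<boxtimes> W) (J t)" for t
    unfolding independent_set_def
  proof (intro conjI ballI impI)
    show "J t \<subseteq> pverts (H \<boxtimes> W)" by (auto simp: J_def strong_product_def)
  next
    fix x y assume xy: "x \<in> J t" "y \<in> J t" "x \<noteq> y"
    obtain p v q w where [simp]: "x = (p, v)" "y = (q, w)" by (metis surj_pair)
    let ?p = "(f p + t) mod int n" and ?q = "(f q + t) mod int n"
    have pq: "(?p, v) \<in> I" "(?q, w) \<in> I" using xy by (auto simp: J_def)
    show "(x, y) \<notin> parcs (H \<boxtimes> W)"
    proof
      assume arc: "(x, y) \<in> parcs (H \<boxtimes> W)"
      \<comment> \<open>Without loops, adjacent vertices cannot merge, so distinct adjacent pairs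
        stay distinct even when \<open>v = w\<close>.\<close>
      have "?p \<noteq> ?q" if "(p, q) \<in> parcs H"
        using rot[OF that, of t] pair_graphD(4)[OF pair_graph_cayley_cycle[OF k]] by metis
      with arc rot[of p q t] xy(3) pq verts[OF pq(1)] verts[OF pq(2)]
      have "(?p, v) \<noteq> (?q, w)" "((?p, v), (?q, w)) \<in> parcs (?G \<boxtimes> W)"
        by (auto simp: strong_product_def)
      with I(1) pq show False by (auto simp: independent_set_def)
    qed
  qed
  then have cardJ: "card (J t) \<le> independence_number (H \<boxtimes> W)" for t
    by (intro card_le_independence_number finite_pverts_strong_product finH finW)
  \<comment> \<open>The rotation by \<open>a - f p\<close> is the one that carries
    \<open>f p\<close> to \<open>a\<close>.\<close>
  let ?h = "\<lambda>(p, (a, w)). ((a - f p) mod int n, (p, w))"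
  have "inj_on ?h (pverts H \<times> I)"
  proof (rule inj_onI, clarsimp)
    fix p a w b assume ab: "(a, w) \<in> I" "(b, w) \<in> I"
      and "(a - f p) mod int n = (b - f p) mod int n"
    then have "int n dvd a - b" by (simp add: mod_eq_dvd_iff)
    from eq_of_dvd_diff[OF this] show "a = b" using verts[OF ab(1)] verts[OF ab(2)] by auto
  qed
  moreover have "?h ` (pverts H \<times> I) \<subseteq> Sigma {0..<int n} J"
    using n verts by (auto simp: J_def mod_simps)
  moreover have "finite (Sigma {0..<int n} J)" using finJ by blast
  ultimately have "card (pverts H \<times> I) \<le> card (Sigma {0..<int n} J)" by (rule card_inj_on_le)
  also have "\<dots> = (\<Sum>t\<in>{0..<int n}. card (J t))" using finJ by (intro card_SigmaI) auto
  also have "\<dots> \<le> (\<Sum>t\<in>{0..<int n}. independence_number (H \<boxtimes> W))" using cardJ by (intro sum_mono)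
  finally show ?thesis using I(2) by (simp add: card_cartesian_product)
qed

section \<open>The winding homomorphism\<close>

definition wind :: "nat \<Rightarrow> nat \<Rightarrow> nat \<Rightarrow> int \<Rightarrow> int" where
  "wind n k l p = (if p < int (l * n) then p mod int n else (p - int (l * n)) mod (int k + 1))"

lemma wind_range:
  assumes "k < n"
  shows "wind n k l p \<in> {0..<int n}"
proof -
  have "(p - int (l * n)) mod (int k + 1) < int k + 1" by (rule pos_mod_bound) simp
  with assms show ?thesis by (auto simp: wind_def)
qed

text \<open>Steps out of the winding part change the image by \<open>d\<close> modulo
  \<open>n\<close>. Steps out of the clique part join two vertices of the clique
  \<open>{0, ..., k}\<close>, distinct because \<open>k + 1\<close> does not divide
  \<open>d\<close>.\<close>

lemma wind_step:
  assumes k: "k < n" and m: "m = l * n + s * (k + 1)"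
    and p: "0 \<le> p" "p < int m" and d: "1 \<le> d" "d \<le> int k" and km: "k < m"
  shows "(wind n k l ((p + d) mod int m), wind n k l p) \<in> parcs (cayley_cycle n k)"
proof -
  let ?q = "(p + d) mod int m" and ?L = "int (l * n)"
  have q: "?q = p + d \<or> ?q = p + d - int m"
  proof (cases "p + d < int m")
    case False
    have "(p + d - int m) mod int m = p + d - int m"
      using False p d km by (intro mod_pos_pos_trivial) auto
    then show ?thesis by simp
  qed (use p d in simp)
  have small: "(a, b) \<in> parcs (cayley_cycle n k)"
    if "0 \<le> a" "a \<le> int k" "0 \<le> b" "b \<le> int k" "a \<noteq> b" for a b
    using that k by (intro cayley_cycle_arcI[of _ _ _ "a - b"]) auto
  have wrange: "wind n k l r \<in> {0..<int n}" for r by (rule wind_range[OF k])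
  have step: ?thesis if "int n dvd wind n k l ?q - wind n k l p - d"
    using that d wrange by (intro cayley_cycle_arcI[of _ _ _ d]) auto
  have low: "int n dvd wind n k l r - r" if "r < ?L" for r
    using that by (simp add: wind_def mod_eq_dvd_iff [symmetric])
  have high: "0 \<le> wind n k l r" "wind n k l r \<le> int k" "(int k + 1) dvd wind n k l r - (r - ?L)"
    if "\<not> r < ?L" for r
  proof -
    have "(r - ?L) mod (int k + 1) < int k + 1" by (rule pos_mod_bound) simp
    with that show "0 \<le> wind n k l r" "wind n k l r \<le> int k" by (auto simp: wind_def)
    show "(int k + 1) dvd wind n k l r - (r - ?L)"
      using that by (simp add: wind_def mod_eq_dvd_iff [symmetric])
  qed
  have Ln: "int n dvd ?L" by simp
  have mL: "int m = ?L + int s * (int k + 1)" using m by (simp add: algebra_simps)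
  have kdm: "(int k + 1) dvd int m - ?L" using mL by simp
  have k_nd: False if "(int k + 1) dvd d" using zdvd_imp_le[OF that] d by simp
  show ?thesis
  proof (cases "p < ?L"; cases "?q < ?L")
    assume A: "p < ?L" "?q < ?L"
    have "int n dvd ?q - (p + d)"
    proof (cases "?q = p + d")
      case False
      with q have q': "?q = p + d - int m" by simp
      have "0 \<le> ?q" using km by simp
      then have nonneg: "0 \<le> p + d - int m" unfolding q' .
      \<comment> \<open>The clique part has length a multiple of \<open>k + 1\<close>, so a step of
        at most \<open>k\<close> can jump over it only if it is empty.\<close>
      have "int m = ?L"
      proof (rule ccontr)
        assume "int m \<noteq> ?L"
        moreover have "?L \<le> int m" unfolding of_nat_le_iff using m by simp
        ultimately have "int k + 1 \<le> int m - ?L" by (intro zdvd_imp_le[OF kdm]) simp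
        with nonneg A(1) d show False by linarith
      qed
      with q' Ln show ?thesis by simp
    qed simp
    from dvd_add[OF dvd_diff[OF low[OF A(2)] low[OF A(1)]] this] show ?thesis
      by (intro step) (simp add: algebra_simps)
  next
    assume A: "p < ?L" "\<not> ?q < ?L"
    have "?q = p + d"
      using q A p d mL km k by auto
    \<comment> \<open>From \<open>p < ?L\<close> follows \<open>?q - ?L < d \<le> k\<close>, so
      reduction modulo \<open>k + 1\<close> changes nothing.\<close>
    then have "wind n k l ?q = ?q - ?L"
      using A d by (simp add: wind_def)
    then have "wind n k l ?q - wind n k l p - d = - (?L + (wind n k l p - p))"
      using \<open>?q = p + d\<close> by simp
    then show ?thesis
      by (intro step) (simp only: dvd_minus_iff dvd_add[OF Ln low[OF A(1)]])
  next
    assume A: "\<not> p < ?L" "?q < ?L"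
    then have q': "?q = p + d - int m" using q d by auto
    have q0: "0 \<le> ?q" using km by simp
    have "?q < int k" using q' p d by simp
    then have wq: "wind n k l ?q = ?q" using A(2) q0 k by (simp add: wind_def)
    have "wind n k l ?q \<noteq> wind n k l p"
    proof
      assume "wind n k l ?q = wind n k l p"
      with high(3)[OF A(1)] wq q' have "(int k + 1) dvd (p + d - int m) - (p - ?L)" by simp
      from dvd_add[OF this kdm] k_nd show False by (simp add: algebra_simps)
    qed
    with wq q0 \<open>?q < int k\<close> high[OF A(1)] show ?thesis by (intro small) auto
  next
    assume A: "\<not> p < ?L" "\<not> ?q < ?L"
    have dq: "(int k + 1) dvd ?q - (p + d)"
    proof (cases "?q = p + d")
      case False
      with q have q': "?q = p + d - int m" by simp
      have "?q < int k" using q' p d by simp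
      \<comment> \<open>Wrapping around inside the clique part forces \<open>l = 0\<close>; then
        \<open>m\<close> itself is a multiple of \<open>k + 1\<close>.\<close>
      with A(2) k have "?L < int n" by linarith
      then have "l = 0" unfolding of_nat_less_iff by (cases l) auto
      with q' mL show ?thesis by simp
    qed simp
    have "wind n k l ?q \<noteq> wind n k l p"
    proof
      assume "wind n k l ?q = wind n k l p"
      with dvd_diff[OF high(3)[OF A(1)] high(3)[OF A(2)]]
      have "(int k + 1) dvd ?q - p" by (simp add: algebra_simps)
      from dvd_diff[OF this dq] k_nd show False by (simp add: algebra_simps)
    qed
    with high[OF A(1)] high[OF A(2)] show ?thesis by (intro small) auto
  qed
qed

text \<open>A negative shift is a forward step with the endpoints exchanged.\<close>

lemma wind_hom:
  assumes k: "k < n" and m: "m = l * n + s * (k + 1)" and km: "k < m"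
    and arc: "(p, q) \<in> parcs (cayley_cycle m k)"
  shows "(wind n k l p, wind n k l q) \<in> parcs (cayley_cycle n k)"
proof -
  from arc obtain j where pq: "p \<in> {0..<int m}" "q \<in> {0..<int m}"
    and j: "1 \<le> \<bar>j\<bar>" "\<bar>j\<bar> \<le> int k" "int m dvd p - q - j"
    by (auto simp: cayley_cycle_arc_iff)
  show ?thesis
  proof (cases "0 \<le> j")
    case True
    have "p mod int m = (q + j) mod int m" using j(3) by (simp add: mod_eq_dvd_iff algebra_simps)
    then have "p = (q + j) mod int m" using pq by simp
    with wind_step[OF k m, of q j] True pq j km show ?thesis by simp
  next
    case False
    have "int m dvd q - (p + - j)" using dvd_minus_iff[of "int m" "p - q - j"] j(3) by (simp add: algebra_simps)
    then have "q mod int m = (p + - j) mod int m" by (simp only: mod_eq_dvd_iff)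
    then have "q = (p + - j) mod int m" using pq by simp
    with wind_step[OF k m, of p "- j"] False pq j km
    have "(wind n k l q, wind n k l p) \<in> parcs (cayley_cycle n k)" by simp
    then show ?thesis by (rule cayley_cycle_sym)
  qed
qed

section \<open>Upper bound and conclusion\<close>

lemma alpha_star_cayley_cycle_le:
  assumes k: "k < n" and m: "m = l * n + s * (k + 1)" and km: "k < m"
  shows "alpha_star (cayley_cycle n k) (cayley_cycle m k) \<le> ereal (real n / real m)"
  unfolding alpha_star_def
proof (rule SUP_least)
  let ?G = "cayley_cycle n k" and ?H = "cayley_cycle m k"
  fix W :: "nat pair_pre_digraph"
  assume "W \<in> {W. pair_graph W \<and> pverts W \<noteq> {}}"
  then have "finite (pverts W)" using pair_graphD(1) by auto
  then have "card (pverts ?H) * independence_number (?G \<boxtimes> W) \<le> n * independence_number (?H \<boxtimes> W)"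
    using wind_range[OF k] wind_hom[OF k m km] k
    by (intro card_hom_mult_independence_number_le[where f = "wind n k l"]) auto
  then have "real m * real (independence_number (?G \<boxtimes> W)) \<le> real n * real (independence_number (?H \<boxtimes> W))"
    by (simp flip: of_nat_mult)
  then have "real (independence_number (?G \<boxtimes> W)) / real (independence_number (?H \<boxtimes> W)) \<le> real n / real m"
    using km by (cases "independence_number (?H \<boxtimes> W) = 0") (simp_all add: field_simps)
  then show "ereal (real (independence_number (?G \<boxtimes> W)) / real (independence_number (?H \<boxtimes> W)))
      \<le> ereal (real n / real m)" by simp
qed

theorem theorem10:
  fixes n m k :: nat
  assumes "1 \<le> 2 * k" and "2 * k < n" and "n < m" and "n \<noteq> 2 * k + 1"
  shows "alpha_star (cayley_cycle n k) (cayley_cycle m k) \<ge> ereal (real n / real m) \<and>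
    ((\<exists>l s :: nat. m = l * n + s * (k + 1)) \<longrightarrow>
      alpha_star (cayley_cycle n k) (cayley_cycle m k) = ereal (real n / real m))"
proof -
  \<comment> \<open>Excluding \<open>2 * k + 1\<close> sharpens \<open>2 * k < n\<close> to the
    bound required for cliques; at the excluded value the inequality fails by
    \<open>alpha_star_complete_less\<close>.\<close>
  have "k < n" "k < m" "2 * k + 2 \<le> n" using assms by auto
  then show ?thesis
    using alpha_star_cayley_cycle_ge[of k n m] alpha_star_cayley_cycle_le[of k n m]
    by (auto intro: order_antisym)
qed

end
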